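(* Let $N$ be a positive integer. Then $${}_{8}\phi_{7}\left[\begin{matrix}q\sqrt{k},-q\sqrt{k},y,z,aq,bq,k^2q^{N}/(yz),q^{-N}\\ \sqrt{k},-\sqrt{k},qk/y,qk/z,abq,yzq^{1-N}/k,kq^{1+N}\end{matrix};q,q\right]$$ $$=\frac{(1-k/y)(1-k/z)(1-kq^N)(1-kq^N/(yz))}{(1-k)(1-k/(yz))(1-kq^N/y)(1-kq^N/z)}\;{}_{6}\phi_{5}\left[\begin{matrix}y,z,a,b,k^2q^{N}/(yz),q^{-N}\\ k/y,k/z,abq,kq^{N},yzq^{-N}/k\end{matrix};q,q\right].$$
   Context: For an integer $n\ge 0$, $(x;q)_n=\prod_{i=0}^{n-1}(1-xq^i)$. The basic hypergeometric series is ${}_{r+1}\phi_r\left[\begin{matrix}a_1,\dots,a_{r+1}\\ b_1,\dots,b_r\end{matrix};q,x\right]=\sum_{n\ge0}\frac{(a_1;q)_n\cdots(a_{r+1};q)_n}{(q;q)_n(b_1;q)_n\cdots(b_r;q)_n}x^n$; when $q^{-N}$ is an upper parameter the series terminates, and the sum is over $0\le n\le N$. Here $q,k,y,z$ are nonzero complex numbers and $a,b$ are complex numbers such that none of the denominators vanish; $\sqrt k$ is a fixed square root of $k$. *)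

theory Defs
  imports Complex_Main
begin

definition qpoch :: "complex \<Rightarrow> complex \<Rightarrow> nat \<Rightarrow> complex" where
  "qpoch x q n = (\<Prod>i<n. 1 - x * q ^ i)"

definition bhs_denom :: "complex list \<Rightarrow> complex \<Rightarrow> nat \<Rightarrow> complex" where
  "bhs_denom bs q n = qpoch q q n * prod_list (map (\<lambda>b. qpoch b q n) bs)"

definition bhs_term :: "complex list \<Rightarrow> complex list \<Rightarrow> complex \<Rightarrow> complex \<Rightarrow> nat \<Rightarrow> complex" where
  "bhs_term as bs q x n =
     prod_list (map (\<lambda>a. qpoch a q n) as) / bhs_denom bs q n * x ^ n"

(* The basic hypergeometric series with r + 1 upper parameters as and r lower parameters bs.
   Only length as = length bs + 1 is meaningful: for other lengths the usual definition has an
   additional factor that is omitted here. *)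
definition bhs :: "complex list \<Rightarrow> complex list \<Rightarrow> complex \<Rightarrow> complex \<Rightarrow> complex" where
  "bhs as bs q x = (\<Sum>n. bhs_term as bs q x n)"

definition bhs_defined_upto :: "nat \<Rightarrow> complex list \<Rightarrow> complex \<Rightarrow> bool" where
  "bhs_defined_upto N bs q \<longleftrightarrow> (\<forall>n\<le>N. bhs_denom bs q n \<noteq> 0)"

(* If q^(-N) is an upper parameter, then the terms with n > N have numerator 0, hence are 0
   whatever the lower parameters are (0 / 0 = 0), and the series is the sum over 0 \<le> n \<le> N. *)
lemma bhs_terminating:
  assumes "q \<noteq> 0" and "q powi (- int N) \<in> set as"
  shows "bhs as bs q x = (\<Sum>n\<le>N. bhs_term as bs q x n)"
  unfolding bhs_def
proof (rule suminf_finite)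
  fix n assume "n \<notin> {..N}"
  then have "N < n" by simp
  have "1 - q powi (- int N) * q ^ N = 0"
    using assms(1) by (simp add: power_int_minus)
  then have "qpoch (q powi (- int N)) q n = 0"
    using \<open>N < n\<close> unfolding qpoch_def by (intro prod_zero) auto
  then have "0 \<in> set (map (\<lambda>a. qpoch a q n) as)"
    using assms(2) by force
  then have "prod_list (map (\<lambda>a. qpoch a q n) as) = 0"
    by (simp add: prod_list_zero_iff)
  then show "bhs_term as bs q x n = 0"
    by (simp add: bhs_term_def)
qed simp

end

(* The two sides are related by summation by parts.  Since
   (a)_0 (b)_0 / ((q)_0 (abq)_0) + ... + (a)_n (b)_n q^n / ((q)_n (abq)_n)
   equals (aq)_n (bq)_n / ((q)_n (abq)_n), the left-hand side is a sum of these partial sums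
   weighted by the remaining very-well-poised factor.  With c = k^2 q^N / (yz)
   and d = q^(-N) one has yzcd = k^2, and under this condition the weight is the difference
   T_n - T_(n+1), where T_n is the right-hand prefactor times the product of (e)_n / (k/e)_n over
   e = y, z, c, d.  The boundary term T_(N+1) vanishes because of the factor (q^(-N))_(N+1). *)
theory Submission
  imports Defs
begin

lemma qpoch_0 [simp]: "qpoch x q 0 = 1"
  by (simp add: qpoch_def)

lemma qpoch_Suc: "qpoch x q (Suc n) = qpoch x q n * (1 - x * q ^ n)"
  by (simp add: qpoch_def)

lemma qpoch_Suc_left: "qpoch x q (Suc n) = (1 - x) * qpoch (q * x) q n"
  unfolding qpoch_def by (subst prod.lessThan_Suc_shift) (simp add: mult_ac)

text \<open>Both sides are \<open>qpoch x q (Suc n)\<close>, split at its first and at its last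
  factor. This converts between lower parameters \<open>q * (k / e)\<close> and
  \<open>k / e\<close>.\<close>

lemma qpoch_shift: "(1 - x) * qpoch (q * x) q n = qpoch x q n * (1 - x * q ^ n)"
  by (metis qpoch_Suc qpoch_Suc_left)

lemma qpoch_nonzero_mono:
  assumes "qpoch x q n \<noteq> 0" and "m \<le> n"
  shows "qpoch x q m \<noteq> 0"
  using assms unfolding qpoch_def by auto

lemma qpoch_power_int_eq_0:
  assumes "q \<noteq> 0"
  shows "qpoch (q powi (- int N)) q (Suc N) = 0"
  using assms by (simp add: qpoch_Suc power_int_minus)

text \<open>Abel summation: the inner sums begin at 0, so a boundary term arises only at the upper
  end.\<close>

lemma sum_by_parts:
  fixes T u :: "nat \<Rightarrow> 'a::comm_ring"
  shows "(\<Sum>n\<le>N. (T n - T (Suc n)) * (\<Sum>j\<le>n. u j))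
       = (\<Sum>n\<le>N. T n * u n) - T (Suc N) * (\<Sum>j\<le>N. u j)"
  by (induction N) (simp_all add: algebra_simps)

text \<open>The q-Pfaff-Saalschuetz sum with lower parameter \<open>a * b * q\<close>: the parameter
  q^(-n) then occurs above and below and cancels, which leaves a truncated sum. The induction step
  rests on an identity quadratic in \<open>q ^ n\<close>.\<close>

lemma sum_saalschuetz:
  assumes "qpoch q q n \<noteq> 0" and "qpoch (a * b * q) q n \<noteq> 0"
  shows "(\<Sum>j\<le>n. qpoch a q j * qpoch b q j / (qpoch q q j * qpoch (a * b * q) q j) * q ^ j)
       = qpoch (a * q) q n * qpoch (b * q) q n / (qpoch q q n * qpoch (a * b * q) q n)"
  using assms
proof (induction n)
  case (Suc n)
  define x A B where "x = q ^ n" and "A = qpoch (a * q) q n" and "B = qpoch (b * q) q n"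
  have nz: "qpoch q q n \<noteq> 0" "qpoch (a * b * q) q n \<noteq> 0"
      "1 - q * x \<noteq> 0" "1 - a * b * q * x \<noteq> 0"
    using Suc.prems by (auto simp: qpoch_Suc x_def)
  have *: "qpoch a q (Suc n) = (1 - a) * A" "qpoch b q (Suc n) = (1 - b) * B"
    by (simp_all add: qpoch_Suc_left A_def B_def mult.commute)
  have **: "qpoch (a * q) q (Suc n) = A * (1 - a * q * x)"
      "qpoch (b * q) q (Suc n) = B * (1 - b * q * x)"
      "qpoch q q (Suc n) = qpoch q q n * (1 - q * x)"
      "qpoch (a * b * q) q (Suc n) = qpoch (a * b * q) q n * (1 - a * b * q * x)"
      "q ^ Suc n = q * x"
    by (simp_all add: qpoch_Suc A_def B_def x_def)
  have "(1 - q * x) * (1 - a * b * q * x) + (1 - a) * (1 - b) * (q * x)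
      = (1 - a * q * x) * (1 - b * q * x)"
    by (simp add: algebra_simps)
  then have key: "1 + (1 - a) * (1 - b) * (q * x) / ((1 - q * x) * (1 - a * b * q * x))
      = (1 - a * q * x) * (1 - b * q * x) / ((1 - q * x) * (1 - a * b * q * x))"
    using nz(3,4) by (simp add: divide_simps)
  have "(\<Sum>j\<le>Suc n. qpoch a q j * qpoch b q j / (qpoch q q j * qpoch (a * b * q) q j) * q ^ j)
      = A * B / (qpoch q q n * qpoch (a * b * q) q n)
        + (1 - a) * A * ((1 - b) * B)
          / (qpoch q q n * (1 - q * x) * (qpoch (a * b * q) q n * (1 - a * b * q * x))) * (q * x)"
    using Suc.IH[OF nz(1,2)] by (simp add: * ** flip: A_def B_def x_def)
  also have "\<dots> = A * B / (qpoch q q n * qpoch (a * b * q) q n)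
      * (1 + (1 - a) * (1 - b) * (q * x) / ((1 - q * x) * (1 - a * b * q * x)))"
    by (simp add: distrib_left mult_ac)
  also have "\<dots> = A * (1 - a * q * x) * (B * (1 - b * q * x))
      / (qpoch q q n * (1 - q * x) * (qpoch (a * b * q) q n * (1 - a * b * q * x)))"
    unfolding key by (simp add: mult_ac)
  finally show ?case
    by (simp only: **)
qed simp

text \<open>Both products are quartics in \<open>x\<close>. As \<open>y * z * c * d = k ^ 2\<close>,
  their constant, quadratic and quartic coefficients agree, and the cubic coefficient of the
  difference is \<open>- k\<close> times the linear one; hence the factor
  \<open>x * (1 - k * x ^ 2)\<close>. The factor \<open>1 - k / (y * z * d)\<close> equals
  \<open>1 - c / k\<close> and compensates for \<open>1 - k / c\<close> on the right, which the
  telescoping needs.\<close>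

lemma balanced_quartic_factorization:
  fixes k y z c d x :: "'a::field"
  assumes "k \<noteq> 0" "y \<noteq> 0" "z \<noteq> 0" "d \<noteq> 0" and c: "c = k ^ 2 / (y * z * d)"
  shows "((1 - k / y * x) * (1 - k / z * x) * (1 - k / c * x) * (1 - k / d * x)
           - (1 - y * x) * (1 - z * x) * (1 - c * x) * (1 - d * x)) * (1 - k / (y * z * d))
       = x * (1 - k * x ^ 2)
         * ((1 - k / c) * (1 - k / (y * z)) * (1 - k / (d * y)) * (1 - k / (d * z)))"
proof -
  \<comment> \<open>Since \<open>p\<close> equals \<open>k ^ 2 / c\<close>, it eliminates
    \<open>c\<close> and leaves \<open>k\<close>, \<open>y\<close>, \<open>z\<close>,
    \<open>d\<close> and \<open>x\<close> as free variables.\<close>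
  define p where "p = y * z * d"
  have p: "p \<noteq> 0"
    using assms by (simp add: p_def)
  have kc: "k / c = p / k" "c = k ^ 2 / p"
    using assms(1) by (simp_all add: c p_def power2_eq_square)
  \<comment> \<open>\<open>F\<close> and \<open>G\<close> are the numerators of the two products,
    and \<open>H\<close> is that of the constant on the right apart from its factor
    \<open>k - p\<close>.\<close>
  define F where "F = (y - k * x) * (z - k * x) * (k - p * x) * (d - k * x)"
  define G where "G = (1 - y * x) * (1 - z * x) * (p - k ^ 2 * x) * (1 - d * x)"
  define H where "H = (y * z - k) * (d * y - k) * (d * z - k)"
  have poly: "F - k * G = - (x * (1 - k * x ^ 2) * H)"
    unfolding F_def G_def H_def p_def by (simp add: algebra_simps power2_eq_square)
  have "1 - k / y * x = (y - k * x) / y" "1 - k / z * x = (z - k * x) / z"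
      "1 - k / c * x = (k - p * x) / k" "1 - k / d * x = (d - k * x) / d"
    unfolding kc(1) using assms(1-4) by (simp_all add: diff_divide_distrib)
  then have F: "(1 - k / y * x) * (1 - k / z * x) * (1 - k / c * x) * (1 - k / d * x) = F / (p * k)"
    by (simp add: F_def p_def mult_ac)
  have "1 - c * x = (p - k ^ 2 * x) / p"
    unfolding kc using p by (simp add: divide_simps)
  then have G: "(1 - y * x) * (1 - z * x) * (1 - c * x) * (1 - d * x) = G / p"
    by (simp add: G_def)
  have "1 - k / (y * z) = (y * z - k) / (y * z)" "1 - k / (d * y) = (d * y - k) / (d * y)"
      "1 - k / (d * z) = (d * z - k) / (d * z)" "1 - k / c = (k - p) / k"
    unfolding kc(1) using assms(1-4) by (simp_all add: divide_simps)
  then have H: "(1 - k / c) * (1 - k / (y * z)) * (1 - k / (d * y)) * (1 - k / (d * z))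
      = (k - p) * H / (k * p ^ 2)"
    by (simp add: H_def p_def power2_eq_square mult_ac)
  have w: "1 - k / p = (p - k) / p"
    using p by (simp add: divide_simps)
  have "(F / (p * k) - G / p) * ((p - k) / p) = (F - k * G) * (p - k) / (k * p ^ 2)"
    using p assms(1) by (simp add: power2_eq_square divide_simps)
  \<comment> \<open>The numerators \<open>p - k\<close> of \<open>1 - k / p\<close> and
    \<open>k - p\<close> of \<open>1 - k / c\<close> differ in sign, which absorbs the minus sign of
    \<open>poly\<close>.\<close>
  also have "(F - k * G) * (p - k) = x * (1 - k * x ^ 2) * ((k - p) * H)"
    unfolding poly by (simp add: algebra_simps)
  finally show ?thesis
    unfolding F G H unfolding w p_def[symmetric] by simp
qed

text \<open>Passing from \<open>T n\<close> to \<open>T (Suc n)\<close> multiplies by a quotient of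
  the two quartics at \<open>x = q ^ n\<close>, so the difference contains the difference of the
  quartics, which factors. The constants of that factorization cancel against the prefactor.\<close>

lemma very_well_poised_telescope:
  assumes nz: "k \<noteq> 0" "y \<noteq> 0" "z \<noteq> 0" "d \<noteq> 0" and c: "c = k ^ 2 / (y * z * d)"
    and C: "(1 - k) * (1 - k / (y * z)) * (1 - k / (d * y)) * (1 - k / (d * z)) \<noteq> 0"
    and den: "\<forall>e\<in>{y, z, c, d}. qpoch (k / e) q (Suc n) \<noteq> 0"
  defines "T \<equiv> \<lambda>n. (1 - k / y) * (1 - k / z) * (1 - k / d) * (1 - k / (y * z * d))
           / ((1 - k) * (1 - k / (y * z)) * (1 - k / (d * y)) * (1 - k / (d * z)))
           * ((qpoch y q n / qpoch (k / y) q n) * (qpoch z q n / qpoch (k / z) q n)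
              * (qpoch c q n / qpoch (k / c) q n) * (qpoch d q n / qpoch (k / d) q n))"
  shows "T n - T (Suc n) = (1 - k * (q ^ n) ^ 2) / (1 - k)
           * ((qpoch y q n / qpoch (q * (k / y)) q n) * (qpoch z q n / qpoch (q * (k / z)) q n)
              * (qpoch c q n / qpoch (q * (k / c)) q n) * (qpoch d q n / qpoch (q * (k / d)) q n))
           * q ^ n"
proof -
  define x where "x = q ^ n"
  define P where "P = (qpoch y q n / qpoch (k / y) q n) * (qpoch z q n / qpoch (k / z) q n)
              * (qpoch c q n / qpoch (k / c) q n) * (qpoch d q n / qpoch (k / d) q n)"
  \<comment> \<open>The prefactor contains \<open>1 - k / e\<close> only for \<open>e\<close> among
    \<open>y\<close>, \<open>z\<close>, \<open>d\<close>. The fourth such factor, \<open>v\<close>,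
    comes from the factorization in exchange for \<open>w\<close>.\<close>
  define L where "L = (1 - k / y) * (1 - k / z) * (1 - k / d)"
  define w where "w = 1 - k / (y * z * d)"
  define v where "v = 1 - k / c"
  define m where "m = 1 - k * x ^ 2"
  define D where "D = (1 - k / (y * z)) * (1 - k / (d * y)) * (1 - k / (d * z))"
  define F where "F = (1 - k / y * x) * (1 - k / z * x) * (1 - k / c * x) * (1 - k / d * x)"
  define G where "G = (1 - y * x) * (1 - z * x) * (1 - c * x) * (1 - d * x)"
  have d1: "qpoch (k / e) q n \<noteq> 0" "1 - k / e * x \<noteq> 0" "1 - k / e \<noteq> 0"
    if "e \<in> {y, z, c, d}" for e
  proof -
    have "qpoch (k / e) q (Suc n) \<noteq> 0"
      using den that by blast
    then show "qpoch (k / e) q n \<noteq> 0" "1 - k / e * x \<noteq> 0" "1 - k / e \<noteq> 0"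
      by (simp_all add: qpoch_Suc x_def, simp add: qpoch_Suc_left flip: qpoch_Suc)
  qed
  have F0: "F \<noteq> 0"
    using d1(2) by (simp add: F_def)
  have CD: "1 - k \<noteq> 0" "D \<noteq> 0"
    using C by (auto simp: D_def)
  have shift: "qpoch e q n / qpoch (q * (k / e)) q n
      = qpoch e q n / qpoch (k / e) q n * ((1 - k / e) / (1 - k / e * x))"
    if "e \<in> {y, z, c, d}" for e
  proof -
    have "qpoch (q * (k / e)) q n = qpoch (k / e) q n * (1 - k / e * x) / (1 - k / e)"
      using qpoch_shift[of "k / e" q n] d1(3)[OF that] by (simp add: x_def field_simps)
    then show ?thesis
      by simp
  qed
  have fac: "(F - G) * w = x * m * (v * D)"
    using balanced_quartic_factorization[OF nz c, of x]
    by (simp add: F_def G_def D_def w_def v_def m_def mult.assoc)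
  have Tn: "T n = L * w / ((1 - k) * D) * P"
    by (simp add: T_def L_def w_def D_def P_def mult.assoc)
  have "T (Suc n) = L * w / ((1 - k) * D) * (P * (G / F))"
    by (simp add: T_def L_def w_def D_def P_def F_def G_def qpoch_Suc mult_ac flip: x_def)
  then have "T n - T (Suc n) = L * P * ((F - G) * w) / ((1 - k) * D * F)"
    using F0 CD unfolding Tn by (simp add: field_simps)
  also have "\<dots> = m / (1 - k) * (P * (L * v / F)) * x"
    using F0 CD unfolding fac by (simp add: field_simps)
  \<comment> \<open>By \<open>shift\<close>, each quotient contributes
    \<open>(1 - k / e) / (1 - k / e * x)\<close>; the four numerators make up \<open>L * v\<close>,
    the denominators \<open>F\<close>.\<close>
  also have "P * (L * v / F)
      = (qpoch y q n / qpoch (q * (k / y)) q n) * (qpoch z q n / qpoch (q * (k / z)) q n)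
        * (qpoch c q n / qpoch (q * (k / c)) q n) * (qpoch d q n / qpoch (q * (k / d)) q n)"
    by (simp only: shift insertI1 insertI2)
       (simp add: P_def L_def v_def F_def mult_ac)
  finally show ?thesis
    by (simp add: x_def m_def)
qed

theorem corollary6:
  fixes q k sqrtk y z a b :: complex and N :: nat
  assumes "N > 0"
    and "q \<noteq> 0" and "k \<noteq> 0" and "y \<noteq> 0" and "z \<noteq> 0"
    and "sqrtk ^ 2 = k"
    and "bhs_defined_upto N
           [sqrtk, - sqrtk, q * k / y, q * k / z, a * b * q,
            y * z * q powi (1 - int N) / k, k * q ^ (1 + N)] q"
    and "bhs_defined_upto N
           [k / y, k / z, a * b * q, k * q ^ N, y * z * q powi (- int N) / k] q"
    and "(1 - k) * (1 - k / (y * z)) * (1 - k * q ^ N / y) * (1 - k * q ^ N / z) \<noteq> 0"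
  shows "bhs [q * sqrtk, - (q * sqrtk), y, z, a * q, b * q,
              k ^ 2 * q ^ N / (y * z), q powi (- int N)]
             [sqrtk, - sqrtk, q * k / y, q * k / z, a * b * q,
              y * z * q powi (1 - int N) / k, k * q ^ (1 + N)] q q
       = (1 - k / y) * (1 - k / z) * (1 - k * q ^ N) * (1 - k * q ^ N / (y * z))
           / ((1 - k) * (1 - k / (y * z)) * (1 - k * q ^ N / y) * (1 - k * q ^ N / z))
         * bhs [y, z, a, b, k ^ 2 * q ^ N / (y * z), q powi (- int N)]
               [k / y, k / z, a * b * q, k * q ^ N, y * z * q powi (- int N) / k] q q"
proof -
  define c d where "c = k ^ 2 * q ^ N / (y * z)" and "d = q powi (- int N)"
  define u where "u n = qpoch a q n * qpoch b q n / (qpoch q q n * qpoch (a * b * q) q n) * q ^ n"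
    for n
  define C where "C = (1 - k / y) * (1 - k / z) * (1 - k * q ^ N) * (1 - k * q ^ N / (y * z))
           / ((1 - k) * (1 - k / (y * z)) * (1 - k * q ^ N / y) * (1 - k * q ^ N / z))"
  define T where "T n = C
           * ((qpoch y q n / qpoch (k / y) q n) * (qpoch z q n / qpoch (k / z) q n)
              * (qpoch c q n / qpoch (k / c) q n) * (qpoch d q n / qpoch (k / d) q n))" for n
  have d: "d = inverse (q ^ N)" "d \<noteq> 0"
    using assms(2) by (simp_all add: d_def power_int_minus)
  \<comment> \<open>This is the balancing condition \<open>y * z * c * d = k ^ 2\<close>.\<close>
  have c: "c = k ^ 2 / (y * z * d)"
    by (simp add: c_def d divide_inverse mult_ac)
  \<comment> \<open>The lower parameters paired with \<open>y\<close>, \<open>z\<close>,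
    \<open>c\<close>, \<open>d\<close> are \<open>k / e\<close> in the series on the right and
    \<open>q * (k / e)\<close> in that on the left.\<close>
  have kd: "k / d = k * q ^ N" "k / c = y * z * d / k" "k / (d * y) = k * q ^ N / y"
      "k / (d * z) = k * q ^ N / z" "k / (y * z * d) = k * q ^ N / (y * z)"
    using assms(2-5) d by (simp_all add: c power2_eq_square field_simps)
  have qkd: "q * (k / y) = q * k / y" "q * (k / z) = q * k / z" "q * (k / d) = k * q ^ (1 + N)"
      "q * (k / c) = y * z * q powi (1 - int N) / k"
  proof -
    have "q powi (1 - int N) = q * d"
      using assms(2) by (simp add: d power_int_diff divide_inverse)
    then show "q * (k / c) = y * z * q powi (1 - int N) / k"
      by (simp add: kd(2))
  qed (simp_all add: kd(1))
  have den1: "bhs_denom [sqrtk, - sqrtk, q * (k / y), q * (k / z), a * b * q,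
      q * (k / c), q * (k / d)] q N \<noteq> 0"
    using assms(7) unfolding bhs_defined_upto_def qkd by blast
  have den2: "bhs_denom [k / y, k / z, a * b * q, k / d, k / c] q N \<noteq> 0"
    using assms(8) unfolding kd unfolding bhs_defined_upto_def d_def by blast
  \<comment> \<open>The factor \<open>1 - k / e\<close> occurs in \<open>qpoch (k / e) q N\<close>
    because \<open>N\<close> is positive.\<close>
  have k1: "k / e \<noteq> 1" if "e \<in> {y, z, c, d}" for e
  proof -
    have "qpoch (k / e) q N \<noteq> 0"
      using den2 that by (auto simp: bhs_denom_def)
    then have "qpoch (k / e) q 1 \<noteq> 0"
      by (rule qpoch_nonzero_mono) (use assms(1) in simp)
    then show ?thesis
      by (simp add: qpoch_Suc)
  qed
  \<comment> \<open>The telescoping at \<open>n = N\<close> needs one factor more than the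
    right-hand series provides; it is supplied by the denominators on the left, which start at
    \<open>q * (k / e)\<close>.\<close>
  have kN: "qpoch (k / e) q (Suc n) \<noteq> 0" if "e \<in> {y, z, c, d}" "n \<le> N" for e n
  proof -
    have "qpoch (q * (k / e)) q N \<noteq> 0"
      using den1 that(1) by (auto simp: bhs_denom_def)
    then have "qpoch (k / e) q (Suc N) \<noteq> 0"
      using k1[OF that(1)] by (simp add: qpoch_Suc_left)
    then show ?thesis
      by (rule qpoch_nonzero_mono) (use that(2) in simp)
  qed
  have q0: "qpoch q q n \<noteq> 0" "qpoch (a * b * q) q n \<noteq> 0"
      "qpoch sqrtk q n \<noteq> 0" "qpoch (- sqrtk) q n \<noteq> 0" if "n \<le> N" for n
    using den1 that by (auto simp: bhs_denom_def dest: qpoch_nonzero_mono)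
  \<comment> \<open>The parameters with \<open>sqrtk\<close> make up the very-well-poised factor:
    each pair telescopes, and the two results combine as differences of squares.\<close>
  have sqrt: "qpoch (q * sqrtk) q n * qpoch (- (q * sqrtk)) q n
      / (qpoch sqrtk q n * qpoch (- sqrtk) q n) = (1 - k * (q ^ n) ^ 2) / (1 - k)"
    if "n \<le> N" for n
  proof -
    have k: "1 - k = (1 - sqrtk) * (1 + sqrtk)"
        "1 - k * (q ^ n) ^ 2 = (1 - sqrtk * q ^ n) * (1 + sqrtk * q ^ n)"
      using assms(6) by (auto simp: algebra_simps power2_eq_square)
    have "((1 - sqrtk) * qpoch (q * sqrtk) q n) * ((1 + sqrtk) * qpoch (- (q * sqrtk)) q n)
        = (qpoch sqrtk q n * (1 - sqrtk * q ^ n)) * (qpoch (- sqrtk) q n * (1 + sqrtk * q ^ n))"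
      using qpoch_shift[of sqrtk q n] qpoch_shift[of "- sqrtk" q n] by simp
    moreover have "1 - k \<noteq> 0"
      using assms(9) by auto
    ultimately show ?thesis
      using q0[OF that] by (simp add: k frac_eq_eq) (simp add: mult_ac)
  qed
  \<comment> \<open>The parameters \<open>a * q\<close>, \<open>b * q\<close> and
    \<open>a * b * q\<close>, with \<open>qpoch q q n\<close>, form the partial sum of
    \<open>u\<close>; all others, with the power of \<open>q\<close>, form the difference of
    \<open>T\<close>.\<close>
  have left: "bhs_term [q * sqrtk, - (q * sqrtk), y, z, a * q, b * q, c, d]
      [sqrtk, - sqrtk, q * (k / y), q * (k / z), a * b * q, q * (k / c), q * (k / d)] q q n
      = (T n - T (Suc n)) * (\<Sum>j\<le>n. u j)" if n: "n \<le> N" for n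
  proof -
    have "(1 - k) * (1 - k / (y * z)) * (1 - k / (d * y)) * (1 - k / (d * z)) \<noteq> 0"
      using assms(9) by (simp add: kd)
    moreover have "\<forall>e\<in>{y, z, c, d}. qpoch (k / e) q (Suc n) \<noteq> 0"
      using kN n by blast
    ultimately have T: "T n - T (Suc n)
        = qpoch (q * sqrtk) q n * qpoch (- (q * sqrtk)) q n
           / (qpoch sqrtk q n * qpoch (- sqrtk) q n)
          * ((qpoch y q n / qpoch (q * (k / y)) q n) * (qpoch z q n / qpoch (q * (k / z)) q n)
             * (qpoch c q n / qpoch (q * (k / c)) q n) * (qpoch d q n / qpoch (q * (k / d)) q n))
          * q ^ n"
      using very_well_poised_telescope[OF assms(3-5) d(2) c, of q n]
      unfolding sqrt[OF n] T_def C_def kd by simp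
    have U: "(\<Sum>j\<le>n. u j)
        = qpoch (a * q) q n * qpoch (b * q) q n / (qpoch q q n * qpoch (a * b * q) q n)"
      unfolding u_def using q0[OF n] by (intro sum_saalschuetz)
    show ?thesis
      unfolding T U by (simp add: bhs_term_def bhs_denom_def mult_ac)
  qed
  \<comment> \<open>Only factors are regrouped, so no bound on \<open>n\<close> is required:
    inversion is multiplicative even with \<open>inverse 0 = 0\<close>.\<close>
  have right: "C * bhs_term [y, z, a, b, c, d] [k / y, k / z, a * b * q, k / d, k / c] q q n
      = T n * u n" for n
    by (simp add: bhs_term_def bhs_denom_def T_def u_def mult_ac)
  have "T (Suc N) = 0"
    using qpoch_power_int_eq_0[OF assms(2)] by (simp add: T_def d_def)
  have "(\<Sum>n\<le>N. bhs_term [q * sqrtk, - (q * sqrtk), y, z, a * q, b * q, c, d]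
      [sqrtk, - sqrtk, q * (k / y), q * (k / z), a * b * q, q * (k / c), q * (k / d)] q q n)
    = (\<Sum>n\<le>N. (T n - T (Suc n)) * (\<Sum>j\<le>n. u j))"
    by (intro sum.cong refl left) simp
  also have "\<dots> = (\<Sum>n\<le>N. T n * u n)"
    unfolding sum_by_parts \<open>T (Suc N) = 0\<close> by simp
  also have "\<dots>
    = C * (\<Sum>n\<le>N. bhs_term [y, z, a, b, c, d] [k / y, k / z, a * b * q, k / d, k / c] q q n)"
    unfolding sum_distrib_left right ..
  finally have "bhs [q * sqrtk, - (q * sqrtk), y, z, a * q, b * q, c, d]
      [sqrtk, - sqrtk, q * (k / y), q * (k / z), a * b * q, q * (k / c), q * (k / d)] q q
    = C * bhs [y, z, a, b, c, d] [k / y, k / z, a * b * q, k / d, k / c] q q"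
    using assms(2) by (subst (1 2) bhs_terminating[where N = N]) (auto simp: d_def)
  then show ?thesis
    unfolding qkd unfolding kd unfolding c_def d_def C_def .
qed

end
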